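(* Consider the Energy Sharing Game $(N,v)$ with admission fees $c_i\ge 0$, $i\in U$, let $\varepsilon^*$ be its least core value, and let $$\hat\varepsilon=\min\Big\{\frac{v(N)-v(S)}{|N|-|S\cap U|}:\ S\in\mathcal{P}^a\Big\}.$$ Suppose $C(N,v)=\emptyset$. Let $\hat S$ be any coalition in $\arg\min\big\{\frac{v(N)-v(S)}{|N|-|S\cap U|}: S\in\mathcal{P}^a\big\}$. Then $\varepsilon^*=\hat\varepsilon$ if and only if $|\hat S|=|N|-1$ and the unique $k\notin\hat S$ satisfies $$v(N)\ge v(S)+\hat\varepsilon\quad\forall\,S\in\mathcal{P}^a_k\qquad\text{and}\qquad v(N)\ge v(S)+2\hat\varepsilon\quad\forall\,S\in\mathcal{P}^a_{-k}.$$
   Context: Energy Sharing Game. The player set is $N=U\cup\{a\}$, where $U$ is a finite set of users with $|U|\ge 2$ and $a\notin U$ is the aggregator. Fix an integer $m\ge 1$. Each user $i\in U$ has: a compact set $D_i\subseteq\mathbb{R}^{n_i}\times\mathbb{R}^{2m}_+$, whose points are written $(z_i,y_i)$ with $y_i=[y_i^+,y_i^-]\in\mathbb{R}^m_+\times\mathbb{R}^m_+$, such that $D_i^z=\{z_i\in\mathbb{R}^{n_i}:(z_i,0)\in D_i\}$ is nonempty; a continuous function $f_i:\mathbb{R}^{n_i+2m}\to\mathbb{R}$; and an admission fee $c_i\ge 0$. There is also a continuous function $f_a:\mathbb{R}^m\to\mathbb{R}_+$ with $f_a(0)=0$. Put $b_i=\max\{f_i(z_i,0):z_i\in D_i^z\}$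 and, for $S\subseteq N$ with $a\in S$ and $|S\cap U|\ge 2$, $$b_S=\max\Big\{\sum_{i\in S\cap U} [f_i(z_i,y_i)-c_i]+f_a\Big(\sum_{i\in S\cap U}y_i^+\Big):\ (z_i,y_i)\in D_i\ (i\in S\cap U),\ \sum_{i\in S\cap U}y_i^+=\sum_{i\in S\cap U}y_i^-\Big\}.$$ The characteristic function is $v(S)=b_S-\sum_{i\in S\cap U}b_i$ if $a\in S$ and $|S\cap U|\ge 2$, and $v(S)=0$ for every other $S\subseteq N$. Notation: $\mathcal{P}=\{S\subseteq N:S\ne\emptyset,S\ne N\}$, $\mathcal{P}^a=\{S\in\mathcal{P}:a\in S\}$, and for $k\in U$, $\mathcal{P}^a_k=\{S\in\mathcal{P}^a:k\in S\}$, $\mathcal{P}^a_{-k}=\{S\in\mathcal{P}^a:k\notin S\}$. For $x\in\mathbb{R}^{|N|}$, $x(S)=\sum_{i\in S}x_i$. The strong $\varepsilon$-core is $C_\varepsilon(N,v)=\{x\in\mathbb{R}^{|N|}:x(N)=v(N),\ x(S)\ge v(S)+\varepsilon\ \forall S\in\mathcal{P}\}$; the core is $C(N,v)=C_0(N,v)$. The least core value is the largest $\varepsilon\in\mathbb{R}$ with $C_\varepsilon(N,v)\ne\emptyset$. *)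

theory Defs
  imports "HOL-Analysis.Analysis"
begin

text \<open>Cooperative games with characteristic function \<open>v\<close> on the player set \<open>N\<close>.
  Payoff vectors are functions in \<^term>\<open>extensional N\<close>, i.e. elements of \<open>\<real>\<^sup>N\<close>.\<close>

definition proper_coalitions :: "'p set \<Rightarrow> 'p set set" where
  "proper_coalitions N = {S. S \<subseteq> N \<and> S \<noteq> {} \<and> S \<noteq> N}"

definition strong_core :: "real \<Rightarrow> 'p set \<Rightarrow> ('p set \<Rightarrow> real) \<Rightarrow> ('p \<Rightarrow> real) set" where
  "strong_core \<epsilon> N v =
     {x \<in> extensional N. sum x N = v N \<and> (\<forall>S\<in>proper_coalitions N. sum x S \<ge> v S + \<epsilon>)}"

definition core :: "'p set \<Rightarrow> ('p set \<Rightarrow> real) \<Rightarrow> ('p \<Rightarrow> real) set" where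
  "core N v = strong_core 0 N v"

definition least_core_value :: "'p set \<Rightarrow> ('p set \<Rightarrow> real) \<Rightarrow> real" where
  "least_core_value N v = (GREATEST \<epsilon>. strong_core \<epsilon> N v \<noteq> {})"

definition coalitions_of :: "'p set \<Rightarrow> 'p \<Rightarrow> 'p set set" where
  "coalitions_of N a = {S \<in> proper_coalitions N. a \<in> S}"

definition coalitions_with :: "'p set \<Rightarrow> 'p \<Rightarrow> 'p \<Rightarrow> 'p set set" where
  "coalitions_with N a k = {S \<in> coalitions_of N a. k \<in> S}"

definition coalitions_without :: "'p set \<Rightarrow> 'p \<Rightarrow> 'p \<Rightarrow> 'p set set" where
  "coalitions_without N a k = {S \<in> coalitions_of N a. k \<notin> S}"

text \<open>A point of the product of a real space of dimension \<open>n i\<close> and one of dimension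
  \<open>2 * m\<close> is encoded as a triple \<open>(z, y\<^sup>+, y\<^sup>-)\<close>. The dimension \<open>n i\<close> depends on the
  user, so \<open>z\<close> lives in \<^term>\<open>Euclidean_space (n i)\<close>, whose points are the real sequences
  vanishing from index \<open>n i\<close> on; \<open>m\<close> is the cardinality of the index type \<open>'m\<close>.\<close>

type_synonym 'm action = "(nat \<Rightarrow> real) \<times> (real ^ 'm) \<times> (real ^ 'm)"

definition action_space :: "nat \<Rightarrow> 'm::finite action topology" where
  "action_space n = prod_topology (Euclidean_space n) euclidean"

locale energy_sharing_game =
  fixes U :: "'p set"
    and a :: 'p
    and n :: "'p \<Rightarrow> nat"
    and D :: "'p \<Rightarrow> 'm::finite action set"
    and f :: "'p \<Rightarrow> 'm action \<Rightarrow> real"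
    and c :: "'p \<Rightarrow> real"
    and fa :: "real ^ 'm \<Rightarrow> real"
  assumes finite_users: "finite U"
    and card_users: "card U \<ge> 2"
    and aggregator: "a \<notin> U"
    and D_compact: "i \<in> U \<Longrightarrow> compactin (action_space (n i)) (D i)"
    and D_nonneg: "i \<in> U \<Longrightarrow> (z, yp, ym) \<in> D i \<Longrightarrow> 0 \<le> yp $ j \<and> 0 \<le> ym $ j"
    and D_alone: "i \<in> U \<Longrightarrow> {z. (z, 0, 0) \<in> D i} \<noteq> {}"
    and f_continuous: "i \<in> U \<Longrightarrow> continuous_map (action_space (n i)) euclideanreal (f i)"
    and fee_nonneg: "i \<in> U \<Longrightarrow> 0 \<le> c i"
    and fa_continuous: "continuous_on UNIV fa"
    and fa_nonneg: "0 \<le> fa q"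
    and fa_zero: "fa 0 = 0"

text \<open>\<open>GREATEST\<close> is the maximum of a possibly infinite set of reals and is unspecified if there is none.
  Under \<^locale>\<open>energy_sharing_game\<close> the maxima below are attained: the feasible sets are compact,
  and nonempty because all \<open>y\<close> may be 0.\<close>

definition individual_benefit ::
  "('p \<Rightarrow> 'm::finite action set) \<Rightarrow> ('p \<Rightarrow> 'm action \<Rightarrow> real) \<Rightarrow> 'p \<Rightarrow> real" where
  "individual_benefit D f i = (GREATEST r. \<exists>z. (z, 0, 0) \<in> D i \<and> r = f i (z, 0, 0))"

definition coalition_benefit ::
  "'p set \<Rightarrow> ('p \<Rightarrow> 'm::finite action set) \<Rightarrow> ('p \<Rightarrow> 'm action \<Rightarrow> real) \<Rightarrow> ('p \<Rightarrow> real)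
     \<Rightarrow> (real ^ 'm \<Rightarrow> real) \<Rightarrow> 'p set \<Rightarrow> real" where
  "coalition_benefit U D f c fa S =
     (GREATEST r. \<exists>z yp ym.
        (\<forall>i\<in>S \<inter> U. (z i, yp i, ym i) \<in> D i) \<and>
        (\<Sum>i\<in>S \<inter> U. yp i) = (\<Sum>i\<in>S \<inter> U. ym i) \<and>
        r = (\<Sum>i\<in>S \<inter> U. f i (z i, yp i, ym i) - c i) + fa (\<Sum>i\<in>S \<inter> U. yp i))"

definition sharing_value ::
  "'p set \<Rightarrow> 'p \<Rightarrow> ('p \<Rightarrow> 'm::finite action set) \<Rightarrow> ('p \<Rightarrow> 'm action \<Rightarrow> real) \<Rightarrow> ('p \<Rightarrow> real)
     \<Rightarrow> (real ^ 'm \<Rightarrow> real) \<Rightarrow> 'p set \<Rightarrow> real" where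
  "sharing_value U a D f c fa S =
     (if a \<in> S \<and> card (S \<inter> U) \<ge> 2
      then coalition_benefit U D f c fa S - (\<Sum>i\<in>S \<inter> U. individual_benefit D f i)
      else 0)"

definition coalition_ratio :: "'p set \<Rightarrow> 'p set \<Rightarrow> ('p set \<Rightarrow> real) \<Rightarrow> 'p set \<Rightarrow> real" where
  "coalition_ratio U N v S = (v N - v S) / (real (card N) - real (card (S \<inter> U)))"

end

theory Submission
  imports Defs
begin

text \<open>Write \<open>T = N - S\<close> for a coalition \<open>S\<close> containing \<open>a\<close>. Since coalitions of users alone have value
  \<open>0\<close>, \<open>x \<in> C\<^sub>\<epsilon>\<close> means \<open>\<epsilon> \<le> x(T) \<le> v(N) - v(N - T) - \<epsilon>\<close> for every nonempty \<open>T \<subseteq> U\<close>. Adding up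
  \<open>\<epsilon> \<le> x(i)\<close> over \<open>i \<in> T\<close> gives \<open>\<epsilon> \<le> \<epsilon>_hat\<close>, and the core is empty exactly when \<open>\<epsilon>_hat < 0\<close>. If
  \<open>x \<in> C\<^sub>\<epsilon>\<close> for \<open>\<epsilon> = \<epsilon>_hat\<close>, all these inequalities are tight on \<open>T_hat = N - S_hat\<close>, so
  \<open>\<epsilon> \<le> x(T_hat) = |T_hat| \<epsilon>\<close>, which for \<open>\<epsilon> < 0\<close> leaves only \<open>T_hat = {k}\<close> and \<open>x(k) = \<epsilon>\<close>. Then
  \<open>x(T) \<ge> 0\<close> whenever \<open>k \<notin> T\<close>, and the two families of inequalities follow. Conversely they say
  that paying \<open>\<epsilon>\<close> to \<open>k\<close>, \<open>v(N) - \<epsilon>\<close> to \<open>a\<close> and \<open>0\<close> to the others is a point of \<open>C\<^sub>\<epsilon>\<close>.\<close>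

section \<open>Compactness of the strong core and attainment of the least core value\<close>

lemma continuous_on_Min_image:
  fixes g :: "'i \<Rightarrow> 'a::topological_space \<Rightarrow> 'b::linorder_topology"
  assumes "finite I" "I \<noteq> {}" "\<And>i. i \<in> I \<Longrightarrow> continuous_on A (g i)"
  shows "continuous_on A (\<lambda>x. Min ((\<lambda>i. g i x) ` I))"
  using assms
proof (induction I rule: finite_ne_induct)
  case (insert i I)
  have "(\<lambda>x. Min ((\<lambda>i. g i x) ` insert i I)) = (\<lambda>x. min (g i x) (Min ((\<lambda>i. g i x) ` I)))"
    using insert by (simp add: Min_insert)
  moreover have "continuous_on A (\<lambda>x. min (g i x) (Min ((\<lambda>i. g i x) ` I)))"
    using insert by (intro continuous_on_min) auto
  ultimately show ?case by (simp only:)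
qed simp

text \<open>Tychonoff's theorem: the type of players may be infinite, so compactness is meant in the
  product topology on functions.\<close>

lemma compact_fun_box:
  fixes L H :: "'p \<Rightarrow> real"
  shows "compact {x. \<forall>i. L i \<le> x i \<and> x i \<le> H i}"
proof -
  have "compactin (product_topology (\<lambda>i. euclidean) UNIV) (Pi\<^sub>E UNIV (\<lambda>i. {L i..H i}))"
    by (subst compactin_PiE) auto
  moreover have "Pi\<^sub>E UNIV (\<lambda>i. {L i..H i}) = {x. \<forall>i. L i \<le> x i \<and> x i \<le> H i}"
    by (auto simp: PiE_UNIV_domain)
  ultimately show ?thesis
    by (simp add: euclidean_product_topology)
qed

lemma continuous_on_sum_coordinates:
  "continuous_on A (\<lambda>x::'p \<Rightarrow> real. sum x S)"
  by (intro continuous_on_sum continuous_on_subset[OF continuous_on_product_coordinates]) auto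

lemma closed_strong_core:
  "closed (strong_core \<epsilon> N v)"
proof -
  have "strong_core \<epsilon> N v =
      (\<Inter>i\<in>-N. {x. x i = undefined}) \<inter> {x. sum x N = v N}
      \<inter> (\<Inter>S\<in>proper_coalitions N. {x. v S + \<epsilon> \<le> sum x S})"
    by (auto simp: strong_core_def extensional_def)
  also have "closed \<dots>"
    by (intro closed_Int closed_INT ballI closed_Collect_eq closed_Collect_le
        continuous_on_sum_coordinates continuous_on_product_coordinates continuous_on_const)
  finally show ?thesis .
qed

lemma singleton_proper:
  assumes "finite N" "2 \<le> card N" "i \<in> N"
  shows "{i} \<in> proper_coalitions N"
  using assms by (auto simp: proper_coalitions_def)

text \<open>Singleton coalitions bound each coordinate from below, and the fixed total
  \<open>v N\<close> then bounds it from above.\<close>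

lemma compact_strong_core:
  assumes N: "finite N" "2 \<le> card N"
  shows "compact (strong_core \<epsilon> N v)"
proof -
  \<comment> \<open>Outside \<open>N\<close> the box shrinks to the single value
    \<open>undefined\<close>, as membership in \<open>extensional N\<close> demands.\<close>
  define L where "L i = (if i \<in> N then v {i} + \<epsilon> else undefined)" for i
  define H where "H i = (if i \<in> N then v N - sum L (N - {i}) else undefined)" for i
  have "strong_core \<epsilon> N v \<subseteq> {x. \<forall>i. L i \<le> x i \<and> x i \<le> H i}"
  proof clarify
    fix x i assume x: "x \<in> strong_core \<epsilon> N v"
    show "L i \<le> x i \<and> x i \<le> H i"
    proof (cases "i \<in> N")
      case True
      have L: "L j \<le> x j" if "j \<in> N" for j
        using x singleton_proper[OF N that] that by (force simp: strong_core_def L_def)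
      have "sum L (N - {i}) \<le> sum x (N - {i})"
        using L by (intro sum_mono) auto
      moreover have "v N = x i + sum x (N - {i})"
        using x True sum.remove[OF N(1) True, of x] by (simp add: strong_core_def)
      ultimately show ?thesis using L True by (simp add: H_def)
    next
      case False
      then show ?thesis using x by (auto simp: strong_core_def extensional_def L_def H_def)
    qed
  qed
  then show ?thesis
    using compact_Int_closed[OF compact_fun_box[of L H] closed_strong_core[of \<epsilon> N v]]
    by (simp only: Int_absorb1)
qed

text \<open>Shows that the maximum behind \<open>GREATEST\<close> exists, so that
  \<open>least_core_value\<close> has its intended meaning.\<close>

lemma least_core_value_attained:
  assumes N: "finite N" "2 \<le> card N"
  shows "strong_core (least_core_value N v) N v \<noteq> {}"
    and "strong_core \<epsilon> N v \<noteq> {} \<Longrightarrow> \<epsilon> \<le> least_core_value N v"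
proof -
  define P where "P = proper_coalitions N"
  \<comment> \<open>\<open>h x\<close> is the largest \<open>\<epsilon>\<close> that an efficient
    payoff vector \<open>x\<close> supports.\<close>
  define h where "h x = Min ((\<lambda>S. sum x S - v S) ` P)" for x
  have P: "finite P" "P \<noteq> {}"
  proof -
    show "finite P"
      using N by (auto simp: P_def proper_coalitions_def intro: finite_subset[of _ "Pow N"])
    have "N \<noteq> {}" using N by auto
    then show "P \<noteq> {}" using singleton_proper[OF N] by (auto simp: P_def)
  qed
  have core_iff: "x \<in> strong_core e N v \<longleftrightarrow> x \<in> extensional N \<and> sum x N = v N \<and> e \<le> h x" for x e
    using P by (auto simp: strong_core_def h_def P_def[symmetric] le_diff_eq add.commute)
  obtain p where p: "p \<in> N" using N by fastforce
  define x0 where "x0 = (\<lambda>i\<in>N. if i = p then v N else 0)"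
  have x0: "x0 \<in> strong_core (h x0) N v"
    using N p by (simp add: core_iff x0_def)
  \<comment> \<open>This strong core is the set of efficient vectors with \<open>h\<close> at least
    \<open>h x0\<close>. It is compact, so \<open>h\<close> has a maximum on it, and efficient
    vectors outside it have smaller \<open>h\<close>.\<close>
  have "continuous_on (strong_core (h x0) N v) h"
    unfolding h_def
    by (intro continuous_on_Min_image P continuous_on_diff continuous_on_sum_coordinates
        continuous_on_const)
  then obtain y where y: "y \<in> strong_core (h x0) N v"
    and max: "\<And>x. x \<in> strong_core (h x0) N v \<Longrightarrow> h x \<le> h y"
    using continuous_attains_sup[OF compact_strong_core[OF N]] x0 by blast
  have ne: "strong_core (h y) N v \<noteq> {}"
    using y core_iff by blast
  have ub: "e \<le> h y" if "strong_core e N v \<noteq> {}" for e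
  proof -
    from that obtain x where x: "x \<in> strong_core e N v" by blast
    have "h x \<le> h y"
    proof (cases "h x0 \<le> h x")
      case True
      then show ?thesis using x max core_iff by blast
    next
      case False
      then show ?thesis using max[OF x0] by linarith
    qed
    then show ?thesis using x by (simp add: core_iff)
  qed
  have "least_core_value N v = h y"
    unfolding least_core_value_def using ne ub by (rule Greatest_equality)
  then show "strong_core (least_core_value N v) N v \<noteq> {}"
    and "strong_core \<epsilon> N v \<noteq> {} \<Longrightarrow> \<epsilon> \<le> least_core_value N v"
    using ne ub by auto
qed

section \<open>Games in which coalitions without \<open>a\<close> are worth nothing\<close>

locale veto_game =
  fixes U N :: "'p set" and a :: 'p and v :: "'p set \<Rightarrow> real"
  assumes finite_U: "finite U" and U_nonempty: "U \<noteq> {}" and a_notin: "a \<notin> U"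
    and N_eq: "N = insert a U"
    and v_without: "a \<notin> S \<Longrightarrow> v S = 0"
begin

lemma N_props: "finite N" "2 \<le> card N"
proof -
  have "0 < card U" using finite_U U_nonempty by (simp add: card_gt_0_iff)
  then show "finite N" "2 \<le> card N"
    using finite_U a_notin by (simp_all add: N_eq)
qed

lemma coalitions_of_iff:
  "S \<in> coalitions_of N a \<longleftrightarrow> (\<exists>T. T \<subseteq> U \<and> T \<noteq> {} \<and> S = N - T)"
proof
  assume "S \<in> coalitions_of N a"
  then have "N - S \<subseteq> U \<and> N - S \<noteq> {} \<and> S = N - (N - S)"
    by (auto simp: coalitions_of_def proper_coalitions_def N_eq)
  then show "\<exists>T. T \<subseteq> U \<and> T \<noteq> {} \<and> S = N - T" by blast
next
  assume "\<exists>T. T \<subseteq> U \<and> T \<noteq> {} \<and> S = N - T"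
  then show "S \<in> coalitions_of N a"
    using a_notin by (auto simp: coalitions_of_def proper_coalitions_def N_eq)
qed

text \<open>A proper coalition is either a nonempty \<open>T\<close> of users, worth 0, or a
  complement \<open>N - T\<close>; efficiency turns the bound on the complement into an upper bound
  on \<open>sum x T\<close>.\<close>

lemma strong_core_iff:
  "x \<in> strong_core \<epsilon> N v \<longleftrightarrow> x \<in> extensional N \<and> sum x N = v N \<and>
     (\<forall>T. T \<subseteq> U \<longrightarrow> T \<noteq> {} \<longrightarrow> \<epsilon> \<le> sum x T \<and> sum x T \<le> v N - v (N - T) - \<epsilon>)"
  (is "_ \<longleftrightarrow> _ \<and> _ \<and> ?bounds")
proof -
  have "(\<forall>S\<in>proper_coalitions N. v S + \<epsilon> \<le> sum x S) \<longleftrightarrow> ?bounds" if x: "sum x N = v N"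
  proof -
    have split: "proper_coalitions N = {T. T \<subseteq> U \<and> T \<noteq> {}} \<union> coalitions_of N a"
      using a_notin by (auto simp: coalitions_of_def proper_coalitions_def N_eq)
    have users: "v T = 0" if "T \<subseteq> U" for T
      using that a_notin v_without by blast
    have compl: "sum x (N - T) = v N - sum x T" if "T \<subseteq> U" for T
      using that x N_props(1) sum_diff[of N T x] by (auto simp: N_eq)
    have coalitions: "coalitions_of N a = (\<lambda>T. N - T) ` {T. T \<subseteq> U \<and> T \<noteq> {}}"
      unfolding set_eq_iff coalitions_of_iff by blast
    have upper: "v (N - T) + \<epsilon> \<le> sum x (N - T) \<longleftrightarrow> sum x T \<le> v N - v (N - T) - \<epsilon>"
      if "T \<subseteq> U" for T
      using compl[OF that] by linarith
    show ?thesis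
      unfolding split ball_Un coalitions using users upper by (simp add: imp_conjR all_conj_distrib) blast
  qed
  then show ?thesis by (auto simp: strong_core_def)
qed

text \<open>The denominator counts the users in \<open>T\<close> together with the aggregator, hence
  the summand 1.\<close>

lemma coalition_ratio_compl:
  assumes "T \<subseteq> U"
  shows "coalition_ratio U N v (N - T) = (v N - v (N - T)) / (1 + real (card T))"
proof -
  have eq: "(N - T) \<inter> U = U - T" using a_notin by (auto simp: N_eq)
  have "card T \<le> card U" "finite T"
    using assms finite_U card_mono finite_subset by auto
  then have "real (card ((N - T) \<inter> U)) = real (card U) - real (card T)"
    using assms by (simp add: eq card_Diff_subset of_nat_diff)
  then show ?thesis
    using finite_U a_notin by (simp add: coalition_ratio_def N_eq)
qed

lemma least_core_value_eq_iff:
  assumes empty: "core N v = {}"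
    and T: "T \<subseteq> U" "T \<noteq> {}" and e: "e = coalition_ratio U N v (N - T)"
    and min: "\<And>S. S \<in> coalitions_of N a \<Longrightarrow> e \<le> coalition_ratio U N v S"
  shows "least_core_value N v = e \<longleftrightarrow>
    (\<exists>k. T = {k} \<and> (\<forall>S\<in>coalitions_with N a k. v S + e \<le> v N) \<and>
      (\<forall>S\<in>coalitions_without N a k. v S + 2 * e \<le> v N))"
    (is "_ \<longleftrightarrow> (\<exists>k. ?R k)")
proof -
  have bound: "(1 + real (card X)) * e \<le> v N - v (N - X)" if "X \<subseteq> U" "X \<noteq> {}" for X
  proof -
    have "e \<le> (v N - v (N - X)) / (1 + real (card X))"
      using min[of "N - X"] that coalition_ratio_compl[of X] by (auto simp: coalitions_of_iff)
    then show ?thesis by (simp add: pos_le_divide_eq mult.commute)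
  qed
  have tight: "v N - v (N - T) = (1 + real (card T)) * e"
    using coalition_ratio_compl[OF T(1)] e by simp
  have e_neg: "e < 0"
  proof (rule ccontr)
    assume "\<not> e < 0"
    \<comment> \<open>If \<open>e\<close> were nonnegative, paying everything to \<open>a\<close>
      would give a point of the core, since \<open>bound\<close> makes every
      \<open>v N - v (N - X)\<close> nonnegative.\<close>
    define x where "x = (\<lambda>i\<in>N. if i = a then v N else 0)"
    have "x \<in> strong_core 0 N v"
      unfolding strong_core_iff
    proof (intro conjI allI impI)
      fix X assume X: "X \<subseteq> U" "X \<noteq> {}"
      have "sum x X = 0"
        using X a_notin by (intro sum.neutral) (auto simp: x_def N_eq)
      moreover have "0 \<le> (1 + real (card X)) * e" using \<open>\<not> e < 0\<close> by simp
      ultimately show "0 \<le> sum x X" "sum x X \<le> v N - v (N - X) - 0"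
        using bound[OF X] by linarith+
    qed (use N_props(1) in \<open>auto simp: x_def N_eq\<close>)
    then show False using empty by (auto simp: core_def)
  qed
  have card_T: "1 \<le> card T"
    using T finite_U finite_subset[OF T(1)] by (auto simp: Suc_le_eq card_gt_0_iff)
  have single: "d \<le> x i" if "x \<in> strong_core d N v" "i \<in> U" for x d i
  proof -
    have "\<forall>X. X \<subseteq> U \<longrightarrow> X \<noteq> {} \<longrightarrow> d \<le> sum x X" using that(1) by (simp add: strong_core_iff)
    from this[rule_format, of "{i}"] show ?thesis using that(2) by simp
  qed
  have upper: "d \<le> e" if d: "strong_core d N v \<noteq> {}" for d
  proof -
    obtain x where x: "x \<in> strong_core d N v" using d by blast
    \<comment> \<open>Each user in \<open>T\<close> receives at least \<open>d\<close>, which the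
      upper bound on \<open>T\<close> limits.\<close>
    have "real (card T) * d \<le> sum x T"
      using sum_bounded_below[of T d x] single[OF x] T by auto
    also have "\<dots> \<le> v N - v (N - T) - d" using x T by (simp add: strong_core_iff)
    finally have "(1 + real (card T)) * d \<le> (1 + real (card T)) * e"
      using tight by (simp add: algebra_simps)
    then show ?thesis by (simp add: mult_le_cancel_left_pos)
  qed
  have "least_core_value N v = e \<longleftrightarrow> strong_core e N v \<noteq> {}"
    using least_core_value_attained[OF N_props, where v = v] upper by (metis order.antisym)
  also have "\<dots> \<longleftrightarrow> (\<exists>k. ?R k)"
  proof
    assume "strong_core e N v \<noteq> {}"
    then obtain x where x: "x \<in> strong_core e N v" by blast
    have lo: "e \<le> sum x X" and hi: "sum x X \<le> v N - v (N - X) - e"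
      if "X \<subseteq> U" "X \<noteq> {}" for X
      using x that by (simp_all add: strong_core_iff)
    have "e \<le> sum x T" by (rule lo[OF T])
    also have "sum x T \<le> real (card T) * e"
      using hi[OF T] tight by (simp add: algebra_simps)
    \<comment> \<open>Dividing by the negative \<open>e\<close> reverses the inequality.\<close>
    finally have "real (card T) \<le> 1"
      using e_neg by (simp add: mult_le_cancel_right1 split: if_splits)
    then have "card T = 1" using card_T by linarith
    then obtain k where k: "T = {k}" by (rule card_1_singletonE)
    have kU: "k \<in> U" using k T by simp
    \<comment> \<open>For one user \<open>tight\<close> reads
      \<open>v N - v (N - T) = 2 * e\<close>, so both bounds on \<open>x k\<close> equal
      \<open>e\<close>.\<close>
    have xk: "x k = e"
      using hi[OF T] lo[OF T] tight k by simp
    \<comment> \<open>Adding \<open>k\<close> to \<open>X\<close> adds exactly \<open>e\<close> to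
      the payoff, which must still be at least \<open>e\<close>.\<close>
    have pos: "0 \<le> sum x X" if X: "X \<subseteq> U" "k \<notin> X" for X
    proof -
      have "finite X" using X finite_U finite_subset by auto
      then show ?thesis using lo[of "insert k X"] X kU xk by simp
    qed
    have "?R k"
    proof (intro conjI ballI)
      fix S assume S: "S \<in> coalitions_with N a k"
      then obtain X where X: "X \<subseteq> U" "X \<noteq> {}" "S = N - X" "k \<notin> X"
        by (auto simp: coalitions_with_def coalitions_of_iff)
      then show "v S + e \<le> v N" using hi[of X] pos[of X] by simp
    next
      fix S assume S: "S \<in> coalitions_without N a k"
      then obtain X where X: "X \<subseteq> U" "X \<noteq> {}" "S = N - X" "k \<in> X"
        using kU N_eq unfolding coalitions_without_def coalitions_of_iff by blast
      \<comment> \<open>The share of \<open>k\<close> supplies the second \<open>e\<close> in the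
        condition on coalitions without \<open>k\<close>.\<close>
      have "sum x X = e + sum x (X - {k})"
        using X finite_U finite_subset xk by (subst sum.remove[of X k]) auto
      moreover have "0 \<le> sum x (X - {k})" using X by (intro pos) auto
      ultimately show "v S + 2 * e \<le> v N" using hi[of X] X by simp
    qed (rule k)
    then show "\<exists>k. ?R k" by blast
  next
    assume "\<exists>k. ?R k"
    then obtain k where k: "?R k" by blast
    have kU: "k \<in> U" "k \<noteq> a" using k T a_notin by auto
    define x where "x = (\<lambda>i\<in>N. if i = a then v N - e else if i = k then e else 0)"
    have sum_x: "sum x X = (if k \<in> X then e else 0)" if "X \<subseteq> U" for X
    proof -
      have "sum x X = (\<Sum>i\<in>X. if i = k then e else 0)"
        using that a_notin by (intro sum.cong) (auto simp: x_def N_eq)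
      then show ?thesis using finite_subset[OF that finite_U] by simp
    qed
    have "x \<in> strong_core e N v"
      unfolding strong_core_iff
    proof (intro conjI allI impI)
      show "x \<in> extensional N" by (simp add: x_def)
      show "sum x N = v N"
        using sum_x[of U] kU finite_U a_notin by (simp add: N_eq x_def)
      fix X assume X: "X \<subseteq> U" "X \<noteq> {}"
      have S: "N - X \<in> coalitions_of N a" using X coalitions_of_iff by blast
      \<comment> \<open>The sum is \<open>e\<close> or 0, and \<open>e\<close> is negative.\<close>
      show "e \<le> sum x X" using sum_x[OF X(1)] e_neg by simp
      show "sum x X \<le> v N - v (N - X) - e"
      proof (cases "k \<in> X")
        case True
        then have "N - X \<in> coalitions_without N a k" using S by (simp add: coalitions_without_def)
        then have "v (N - X) + 2 * e \<le> v N" using k by blast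
        then show ?thesis using sum_x[OF X(1)] True by simp
      next
        case False
        then have "N - X \<in> coalitions_with N a k" using S kU by (simp add: coalitions_with_def N_eq)
        then have "v (N - X) + e \<le> v N" using k by blast
        then show ?thesis using sum_x[OF X(1)] False by simp
      qed
    qed
    then show "strong_core e N v \<noteq> {}" by blast
  qed
  finally show ?thesis .
qed

end

section \<open>The energy sharing game as an instance\<close>

theorem theorem6:
  fixes U N S_hat :: "'p set"
    and a :: 'p
    and n :: "'p \<Rightarrow> nat"
    and D :: "'p \<Rightarrow> 'm::finite action set"
    and f :: "'p \<Rightarrow> 'm action \<Rightarrow> real"
    and c :: "'p \<Rightarrow> real"
    and fa :: "real ^ 'm \<Rightarrow> real"
    and v :: "'p set \<Rightarrow> real"
    and \<epsilon>_hat :: real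
  assumes game: "energy_sharing_game U a n D f c fa"
    and N: "N = insert a U"
    and v: "v = sharing_value U a D f c fa"
    and \<epsilon>_hat: "\<epsilon>_hat = Min {coalition_ratio U N v S | S. S \<in> coalitions_of N a}"
    and empty_core: "core N v = {}"
    and S_hat: "is_arg_min (coalition_ratio U N v) (\<lambda>S. S \<in> coalitions_of N a) S_hat"
  shows "least_core_value N v = \<epsilon>_hat \<longleftrightarrow>
    card S_hat = card N - 1 \<and>
    (\<exists>k. N - S_hat = {k} \<and>
      (\<forall>S\<in>coalitions_with N a k. v N \<ge> v S + \<epsilon>_hat) \<and>
      (\<forall>S\<in>coalitions_without N a k. v N \<ge> v S + 2 * \<epsilon>_hat))"
proof -
  interpret energy_sharing_game U a n D f c fa by (rule game)
  have U: "U \<noteq> {}" using card_users by auto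
  have v_without: "v S = 0" if "a \<notin> S" for S
    unfolding v sharing_value_def using that by simp
  interpret veto_game U N a v
    by (rule veto_game.intro[OF finite_users U aggregator N v_without])
  have S_hat_in: "S_hat \<in> coalitions_of N a"
    and S_hat_min: "\<And>S. S \<in> coalitions_of N a \<Longrightarrow>
      coalition_ratio U N v S_hat \<le> coalition_ratio U N v S"
    using S_hat by (auto simp: is_arg_min_linorder)
  have "finite (coalitions_of N a)"
    using N_props(1)
    by (auto simp: coalitions_of_def proper_coalitions_def intro: finite_subset[of _ "Pow N"])
  then have \<epsilon>_eq: "\<epsilon>_hat = coalition_ratio U N v S_hat"
    unfolding \<epsilon>_hat using S_hat_in S_hat_min by (intro Min_eqI) auto
  obtain T where T: "T \<subseteq> U" "T \<noteq> {}" "S_hat = N - T"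
    using S_hat_in coalitions_of_iff by blast
  have N_S_hat: "N - S_hat = T" using T by (auto simp: N)
  \<comment> \<open>The cardinality condition of the statement comes from the complement being a
    singleton.\<close>
  have card_S_hat: "card S_hat = card N - 1" if "T = {k}" for k
    using T that by (simp add: N)
  have "least_core_value N v = \<epsilon>_hat \<longleftrightarrow>
    (\<exists>k. T = {k} \<and> (\<forall>S\<in>coalitions_with N a k. v S + \<epsilon>_hat \<le> v N) \<and>
      (\<forall>S\<in>coalitions_without N a k. v S + 2 * \<epsilon>_hat \<le> v N))"
    by (rule least_core_value_eq_iff[OF empty_core T(1,2) \<epsilon>_eq[unfolded T(3)]])
      (simp add: \<epsilon>_eq S_hat_min)
  then show ?thesis
    unfolding N_S_hat using card_S_hat by metis
qed

end
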